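(* Let $\alpha\in(0,1)$ and let $z_{\alpha/2}$ be the $(1-\alpha/2)$-th quantile of the standard normal distribution. Let $W$ be a graphon such that $|t(K_2,W)^4-t(C_4,W)|>0$, let $G_n\sim G(n,W)$, and let $$T_n=n^{3/2}\,\frac{\hat t(K_2,G_n)^4-\hat t(C_4,G_n)}{4\sqrt2\;\hat t(K_2,G_n)^3\,(1-\hat t(K_2,G_n))}.$$ Then $\mathbb P(|T_n|>z_{\alpha/2})\to1$ as $n\to\infty$.
   Context: A graphon is a measurable symmetric function $W:[0,1]^2\to[0,1]$. $G(n,W)$ is the random graph on $\{1,\dots,n\}$ obtained from independent i.i.d. $U[0,1]$ families $(U_i)_{i\le n}$ and $(Y_{ij})_{i<j\le n}$ by putting the edge $(i,j)$ iff $Y_{ij}\le W(U_i,U_j)$. $K_2$ is the edge and $C_4$ the 4-cycle. For a finite simple graph $H$, $t(H,W)=\int_{[0,1]^{|V(H)|}}\prod_{(a,b)\in E(H)}W(x_a,x_b)\prod_a\mathrm dx_a$, $X(H,G_n)$ is the number of unlabelled (not necessarily induced) copies of $H$ in $G_n$, and $\hat t(H,G_n)=\frac{|\mathrm{Aut}(H)|}{(n)_{|V(H)|}}X(H,G_n)$ with $(n)_k=n(n-1)\cdots(n-k+1)$ and $\mathrm{Aut}(H)$ the automorphism group. *)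

theory Defs
  imports "HOL-Probability.Probability"
begin

datatype graph = Graph (verts: "nat set") (edges: "nat set set")

definition simple_graph :: "graph \<Rightarrow> bool" where
  "simple_graph G \<longleftrightarrow> finite (verts G) \<and> edges G \<subseteq> {e. e \<subseteq> verts G \<and> card e = 2}"

definition simple_graphs_on :: "nat set \<Rightarrow> graph set" where
  "simple_graphs_on V = {G. simple_graph G \<and> verts G = V}"

definition subgraph :: "graph \<Rightarrow> graph \<Rightarrow> bool" where
  "subgraph S G \<longleftrightarrow> simple_graph S \<and> verts S \<subseteq> verts G \<and> edges S \<subseteq> edges G"

definition graph_iso :: "graph \<Rightarrow> graph \<Rightarrow> bool" where
  "graph_iso H S \<longleftrightarrow> (\<exists>f. bij_betw f (verts H) (verts S) \<and> edges S = (\<lambda>e. f ` e) ` edges H)"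

definition automorphisms :: "graph \<Rightarrow> (nat \<Rightarrow> nat) set" where
  "automorphisms H = {f. f permutes verts H \<and> (\<lambda>e. f ` e) ` edges H = edges H}"

definition K2 :: graph where
  "K2 = Graph {1, 2} {{1, 2}}"

definition C4 :: graph where
  "C4 = Graph {1, 2, 3, 4} {{1, 2}, {2, 3}, {3, 4}, {4, 1}}"

definition num_copies :: "graph \<Rightarrow> graph \<Rightarrow> nat" where
  "num_copies H G = card {S. subgraph S G \<and> graph_iso H S}"

definition falling_factorial :: "nat \<Rightarrow> nat \<Rightarrow> real" where
  "falling_factorial n k = (\<Prod>i<k. real n - real i)"

definition empirical_density :: "graph \<Rightarrow> graph \<Rightarrow> real" where
  "empirical_density H G =
     real (card (automorphisms H)) / falling_factorial (card (verts G)) (card (verts H))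
       * real (num_copies H G)"

definition unif01 :: "real measure" where
  "unif01 = restrict_space lborel {0..1}"

text \<open>
  Values of a graphon outside the unit square are irrelevant: every measure below lives on
  products of the space \<open>{0..1}\<close> of \<^term>\<open>unif01\<close>.  Measurability is Borel measurability.
\<close>

definition graphon :: "(real \<Rightarrow> real \<Rightarrow> real) \<Rightarrow> bool" where
  "graphon W \<longleftrightarrow>
     case_prod W \<in> borel_measurable (unif01 \<Otimes>\<^sub>M unif01) \<and>
     (\<forall>x\<in>{0..1}. \<forall>y\<in>{0..1}. W x y = W y x \<and> 0 \<le> W x y \<and> W x y \<le> 1)"

text \<open>
  Each edge contributes one factor; by symmetry of \<open>W\<close> it may be evaluated at the endpoints in
  increasing order.
\<close>

definition hom_density :: "graph \<Rightarrow> (real \<Rightarrow> real \<Rightarrow> real) \<Rightarrow> real" where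
  "hom_density H W =
     (\<integral>x. (\<Prod>(a, b)\<in>{(a, b). a < b \<and> {a, b} \<in> edges H}. W (x a) (x b))
        \<partial>(\<Pi>\<^sub>M a\<in>verts H. unif01))"

definition vertex_pairs :: "nat \<Rightarrow> (nat \<times> nat) set" where
  "vertex_pairs n = {(i, j). 1 \<le> i \<and> i < j \<and> j \<le> n}"

definition threshold_graph ::
    "nat \<Rightarrow> (real \<Rightarrow> real \<Rightarrow> real) \<Rightarrow> (nat \<Rightarrow> real) \<Rightarrow> (nat \<times> nat \<Rightarrow> real) \<Rightarrow> graph" where
  "threshold_graph n W U Y =
     Graph {1..n} {{i, j} | i j. (i, j) \<in> vertex_pairs n \<and> Y (i, j) \<le> W (U i) (U j)}"

text \<open>
  The law of \<open>G(n,W)\<close>, as a measure on the finite set of simple graphs with vertex set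
  \<open>{1..n}\<close>: the coordinates of the product space are the independent uniform families
  \<open>U\<close> and \<open>Y\<close>.
\<close>

definition W_random_graph :: "nat \<Rightarrow> (real \<Rightarrow> real \<Rightarrow> real) \<Rightarrow> graph measure" where
  "W_random_graph n W =
     distr ((\<Pi>\<^sub>M i\<in>{1..n}. unif01) \<Otimes>\<^sub>M (\<Pi>\<^sub>M p\<in>vertex_pairs n. unif01))
       (count_space (simple_graphs_on {1..n}))
       (\<lambda>(U, Y). threshold_graph n W U Y)"

definition quantile :: "real measure \<Rightarrow> real \<Rightarrow> real" where
  "quantile M p = Inf {x. p \<le> cdf M x}"

text \<open>Where the denominator vanishes, division by zero makes the value \<open>0\<close>.\<close>

definition test_statistic :: "nat \<Rightarrow> graph \<Rightarrow> real" where
  "test_statistic n G =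
     real n powr (3 / 2) *
       ((empirical_density K2 G ^ 4 - empirical_density C4 G) /
        (4 * sqrt 2 * empirical_density K2 G ^ 3 * (1 - empirical_density K2 G)))"

end

theory Submission
  imports Defs
begin

text \<open>
  Since \<open>0 \<le> p\<^sup>3 (1 - p) \<le> 1\<close> for \<open>p \<in> {0..1}\<close>, a gap between \<open>p\<^sup>4\<close>, where \<open>p\<close> is the
  empirical edge density, and the empirical density \<open>q\<close> of 4-cycles is blown up by the test
  statistic at least to the order \<open>n powr (3/2)\<close>, which exceeds every fixed quantile.  The theorem
  is therefore a law of large numbers: the empirical densities of the edge and of the 4-cycle
  converge in probability to \<open>t(K\<^sub>2, W)\<close> and \<open>t(C\<^sub>4, W)\<close>, so the gap stays bounded away from \<open>0\<close>
  with probability tending to one.  The denominator vanishes only for graphs with \<open>p = 0\<close> or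
  \<open>p = 1\<close>; these are edgeless or complete and have \<open>p\<^sup>4 = q\<close>, so a positive gap rules them out
  (\<open>test_statistic_lower_bound\<close>).

  For the law of large numbers, the factor \<open>|Aut(H)|\<close> turns copies of \<open>H\<close> into injective
  homomorphisms (\<open>card_injective_homs\<close>), so the empirical density is the fraction of injections
  \<open>f\<close> from the vertices of \<open>H\<close> into \<open>{1..n}\<close> that preserve edges.  Conditionally on \<open>U\<close> the edges
  are independent, so each \<open>f\<close> does so with probability \<open>t(H, W)\<close>, and two injections with disjoint
  images do so simultaneously with probability \<open>t(H, W)\<^sup>2\<close> (\<open>prob_injective_hom\<close>,
  \<open>prob_two_injective_homs\<close>).  Only a fraction \<open>O(1/n)\<close> of all pairs of injections overlap
  (\<open>overlapping_pairs_fraction\<close>).  This fraction bounds the variance of the empirical density, and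
  Chebyshev's inequality gives \<open>empirical_density_concentration\<close>.
\<close>

section \<open>Copies and injective homomorphisms\<close>

definition injections :: "nat set \<Rightarrow> nat set \<Rightarrow> (nat \<Rightarrow> nat) set" where
  "injections V N = {f \<in> V \<rightarrow>\<^sub>E N. inj_on f V}"

definition injective_homs :: "graph \<Rightarrow> graph \<Rightarrow> (nat \<Rightarrow> nat) set" where
  "injective_homs H G = {f \<in> injections (verts H) (verts G). \<forall>e\<in>edges H. f ` e \<in> edges G}"

lemma finite_injections: "finite V \<Longrightarrow> finite N \<Longrightarrow> finite (injections V N)"
  unfolding injections_def by (simp add: finite_PiE)

lemma edges_subset_verts: "simple_graph H \<Longrightarrow> e \<in> edges H \<Longrightarrow> e \<subseteq> verts H"
  by (auto simp: simple_graph_def)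

lemma image_of_injective_hom:
  assumes H: "simple_graph H" and G: "simple_graph G" and f: "f \<in> injective_homs H G"
  shows "subgraph (Graph (f ` verts H) ((`) f ` edges H)) G"
    and "graph_iso H (Graph (f ` verts H) ((`) f ` edges H))"
proof -
  have inj: "inj_on f (verts H)" and into: "f ` verts H \<subseteq> verts G"
    using f by (auto simp: injective_homs_def injections_def)
  have "f ` e \<subseteq> f ` verts H \<and> card (f ` e) = 2" if e: "e \<in> edges H" for e
    using H e inj by (auto simp: simple_graph_def card_image inj_on_subset dest!: subsetD[of "edges H"])
  then show "subgraph (Graph (f ` verts H) ((`) f ` edges H)) G"
    using f into H by (auto simp: subgraph_def simple_graph_def injective_homs_def)
  show "graph_iso H (Graph (f ` verts H) ((`) f ` edges H))"
    using inj by (auto simp: graph_iso_def bij_betw_def)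
qed

text \<open>
  Every injective homomorphism is an isomorphism onto a unique copy of \<open>H\<close>.  After choosing one
  isomorphism \<open>\<phi> S\<close> for each copy \<open>S\<close>, all others onto \<open>S\<close> are \<open>\<phi> S \<circ> a\<close> for a unique
  automorphism \<open>a\<close>, so that pairs \<open>(a, S)\<close> parametrise the injective homomorphisms.
\<close>

lemma card_injective_homs:
  assumes H: "simple_graph H" and G: "simple_graph G"
  shows "card (injective_homs H G) = card (automorphisms H) * num_copies H G"
proof -
  define V where "V = verts H"
  define C where "C = {S. subgraph S G \<and> graph_iso H S}"
  define \<phi> where
    "\<phi> S = (SOME f. bij_betw f V (verts S) \<and> edges S = (\<lambda>e. f ` e) ` edges H)" for S
  have \<phi>: "bij_betw (\<phi> S) V (verts S)" "edges S = (`) (\<phi> S) ` edges H" if "graph_iso H S" for S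
    using someI_ex[OF that[unfolded graph_iso_def]] unfolding \<phi>_def V_def by auto
  have EV: "e \<subseteq> V" if "e \<in> edges H" for e
    using edges_subset_verts[OF H that] by (simp add: V_def)
  define \<Psi> where "\<Psi> = (\<lambda>(a, S). restrict (\<phi> S \<circ> a) V)"
  have \<Psi>_verts: "\<Psi> (a, S) ` V = verts S" and \<Psi>_edges: "(`) (\<Psi> (a, S)) ` edges H = edges S"
    if a: "a \<in> automorphisms H" and S: "S \<in> C" for a S
  proof -
    have iso: "graph_iso H S" using S by (simp add: C_def)
    have aV: "a ` V = V" and aE: "(`) a ` edges H = edges H"
      using a by (auto simp: automorphisms_def V_def permutes_image)
    have "\<Psi> (a, S) ` V = \<phi> S ` (a ` V)" by (auto simp: \<Psi>_def)
    then show "\<Psi> (a, S) ` V = verts S" using \<phi>(1)[OF iso] aV by (simp add: bij_betw_def)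
    have "\<Psi> (a, S) ` e = \<phi> S ` a ` e" if "e \<in> edges H" for e
      using EV[OF that] unfolding \<Psi>_def by (force simp: image_iff)
    then have "(`) (\<Psi> (a, S)) ` edges H = (`) (\<phi> S) ` ((`) a ` edges H)"
      by (simp add: image_image)
    then show "(`) (\<Psi> (a, S)) ` edges H = edges S" using \<phi>(2)[OF iso] aE by simp
  qed
  have "bij_betw \<Psi> (automorphisms H \<times> C) (injective_homs H G)"
    unfolding bij_betw_def
  proof
    show "inj_on \<Psi> (automorphisms H \<times> C)"
    proof (rule inj_onI, clarify)
      fix a S b T
      assume a: "a \<in> automorphisms H" and b: "b \<in> automorphisms H" and S: "S \<in> C" and T: "T \<in> C"
        and eq: "\<Psi> (a, S) = \<Psi> (b, T)"
      have ST: "S = T"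
        using \<Psi>_verts[OF a S] \<Psi>_verts[OF b T] \<Psi>_edges[OF a S] \<Psi>_edges[OF b T] eq
        by (metis graph.expand)
      have inj: "inj_on (\<phi> S) V" using \<phi>(1)[of S] S by (auto simp: C_def bij_betw_def)
      have pa: "a permutes V" and pb: "b permutes V"
        using a b by (auto simp: automorphisms_def V_def)
      have "a x = b x" for x
      proof (cases "x \<in> V")
        case True
        then have "\<phi> S (a x) = \<phi> S (b x)" using fun_cong[OF eq, of x] ST by (simp add: \<Psi>_def)
        then show ?thesis
          using inj True pa pb by (meson inj_onD permutes_in_image)
      next
        case False
        then show ?thesis using pa pb by (simp add: permutes_not_in)
      qed
      then show "a = b \<and> S = T" using ST by auto
    qed
    show "\<Psi> ` (automorphisms H \<times> C) = injective_homs H G"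
    proof (intro equalityI subsetI)
      fix f assume "f \<in> \<Psi> ` (automorphisms H \<times> C)"
      then obtain a S where a: "a \<in> automorphisms H" and S: "S \<in> C" and f: "f = \<Psi> (a, S)" by auto
      have pa: "a permutes V" using a by (auto simp: automorphisms_def V_def)
      have sub: "verts S \<subseteq> verts G" "edges S \<subseteq> edges G" and iso: "graph_iso H S"
        using S by (auto simp: C_def subgraph_def)
      have "inj_on (\<phi> S) (a ` V)" using \<phi>(1)[OF iso] pa by (simp add: bij_betw_def permutes_image)
      then have "inj_on f V"
        using comp_inj_on[OF permutes_inj_on[OF pa]] by (simp add: f \<Psi>_def)
      moreover have "f \<in> V \<rightarrow>\<^sub>E verts G"
        using \<Psi>_verts[OF a S] sub f by (auto simp: \<Psi>_def)
      moreover have "\<forall>e\<in>edges H. f ` e \<in> edges G"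
        using \<Psi>_edges[OF a S] sub f by auto
      ultimately show "f \<in> injective_homs H G" by (simp add: injective_homs_def injections_def V_def)
    next
      fix f assume f: "f \<in> injective_homs H G"
      define S where "S = Graph (f ` V) ((`) f ` edges H)"
      have S: "S \<in> C" and iso: "graph_iso H S"
        using image_of_injective_hom[OF H G f] by (auto simp: S_def C_def V_def)
      have fV: "inj_on f V" "f \<in> extensional V"
        using f by (auto simp: injective_homs_def injections_def V_def PiE_iff)
      have vS: "verts S = f ` V" and eS: "edges S = (`) f ` edges H" by (simp_all add: S_def)
      have bij: "bij_betw (\<phi> S) V (f ` V)" and ed: "(`) (\<phi> S) ` edges H = (`) f ` edges H"
        using \<phi>[OF iso] vS eS by metis+
      define a where "a x = (if x \<in> V then inv_into V (\<phi> S) (f x) else x)" for x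
      have \<phi>a: "\<phi> S (a x) = f x" if "x \<in> V" for x
        using that bij_betw_inv_into_right[OF bij, of "f x"] by (simp add: a_def)
      have "bij_betw a V V"
      proof -
        have "bij_betw (inv_into V (\<phi> S) \<circ> f) V V"
          by (rule bij_betw_trans[OF inj_on_imp_bij_betw[OF fV(1)] bij_betw_inv_into[OF bij]])
        then show ?thesis by (subst bij_betw_cong[where g = "inv_into V (\<phi> S) \<circ> f"]) (simp_all add: a_def)
      qed
      then have pa: "a permutes V" by (rule bij_imp_permutes) (simp add: a_def)
      have img: "\<phi> S ` a ` e = f ` e" if "e \<in> edges H" for e
        unfolding image_image using EV[OF that] \<phi>a by (intro image_cong) auto
      have same: "(`) (\<phi> S) ` ((`) a ` edges H) = (`) (\<phi> S) ` edges H"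
        using ed img by (simp add: image_image)
      have injP: "inj_on ((`) (\<phi> S)) (Pow V)"
        using bij by (simp add: bij_betw_def inj_on_image_Pow)
      have subs: "(`) a ` edges H \<subseteq> Pow V" "edges H \<subseteq> Pow V"
        using EV permutes_in_image[OF pa] by auto
      have "(`) a ` edges H = edges H"
        using same unfolding inj_on_image_eq_iff[OF injP subs] .
      then have "a \<in> automorphisms H" using pa by (simp add: automorphisms_def V_def)
      moreover have "f = \<Psi> (a, S)"
        using fV(2) \<phi>a by (auto simp: \<Psi>_def fun_eq_iff extensional_def)
      ultimately show "f \<in> \<Psi> ` (automorphisms H \<times> C)" using S by blast
    qed
  qed
  then have "card (injective_homs H G) = card (automorphisms H \<times> C)"
    by (metis bij_betw_same_card)
  then show ?thesis by (simp add: num_copies_def C_def card_cartesian_product)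
qed

section \<open>The uniform cube and products of graphon values\<close>

lemma prob_space_unif01: "prob_space unif01"
  by (rule prob_spaceI) (simp add: unif01_def emeasure_restrict_space space_restrict_space)

lemma space_unif01 [simp]: "space unif01 = {0..1}"
  by (simp add: unif01_def space_restrict_space)

lemma measurable_unif01_borel [measurable]: "(\<lambda>x. x) \<in> borel_measurable unif01"
  unfolding unif01_def by (rule measurable_restrict_space1) simp

lemma emeasure_unif01_atMost:
  assumes "0 \<le> c" "c \<le> 1"
  shows "emeasure unif01 {y \<in> {0..1}. y \<le> c} = ennreal c" "{y \<in> {0..1}. y \<le> c} \<in> sets unif01"
proof -
  have "{y \<in> {0..1}. y \<le> c} = {0..c}" using assms by auto
  then show "emeasure unif01 {y \<in> {0..1}. y \<le> c} = ennreal c" "{y \<in> {0..1}. y \<le> c} \<in> sets unif01"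
    using assms by (auto simp: unif01_def emeasure_restrict_space sets_restrict_space_iff)
qed

lemma prob_space_cube: "prob_space (\<Pi>\<^sub>M i\<in>I. unif01)"
  by (intro prob_space_PiM prob_space_unif01)

lemma in_space_cube: "x \<in> space (\<Pi>\<^sub>M i\<in>I. unif01) \<Longrightarrow> i \<in> I \<Longrightarrow> x i \<in> {0..1}"
  by (auto simp: space_PiM)

text \<open>
  The joint law of all coordinates is the product measure itself, and the marginal laws are its
  factors.
\<close>

lemma indep_vars_coordinates:
  fixes I :: "'i set"
  assumes "I \<noteq> {}"
  shows "prob_space.indep_vars (\<Pi>\<^sub>M i\<in>I. unif01) (\<lambda>i. unif01) (\<lambda>i x. x i) I"
proof -
  interpret P: prob_space "\<Pi>\<^sub>M i\<in>I. unif01" by (rule prob_space_cube)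
  have "distr (\<Pi>\<^sub>M i\<in>I. unif01) unif01 (\<lambda>x. x i) = unif01" if "i \<in> I" for i
    using distr_PiM_component[of I "\<lambda>_. unif01" i] that prob_space_unif01 by simp
  moreover have "distr (\<Pi>\<^sub>M i\<in>I. unif01) (\<Pi>\<^sub>M i\<in>I. unif01) (\<lambda>x. \<lambda>i\<in>I. x i) = (\<Pi>\<^sub>M i\<in>I. unif01)"
    by (rule trans[OF distr_cong distr_id2]) (auto simp: space_PiM PiE_def extensional_restrict)
  ultimately show ?thesis
    using assms by (subst P.indep_vars_iff_distr_eq_PiM') (auto cong: PiM_cong)
qed

lemma graphon_bounds:
  assumes "graphon W" "x \<in> {0..1}" "y \<in> {0..1}"
  shows "W x y = W y x" "0 \<le> W x y" "W x y \<le> 1"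
  using assms by (auto simp: graphon_def)

lemma measurable_graphon_coordinates:
  assumes "graphon W" "i \<in> I" "j \<in> I"
  shows "(\<lambda>x. W (x i) (x j)) \<in> borel_measurable (\<Pi>\<^sub>M i\<in>I. unif01)"
proof -
  have "case_prod W \<in> borel_measurable (unif01 \<Otimes>\<^sub>M unif01)"
    using assms(1) by (simp add: graphon_def)
  from measurable_compose[OF measurable_Pair[OF measurable_component_singleton[OF assms(2)]
        measurable_component_singleton[OF assms(3)]] this]
  show ?thesis by simp
qed

text \<open>
  For \<open>E\<close> a set of increasing pairs of vertices, this is the conditional probability, given the
  types \<open>x\<close> of the vertices, that all pairs in \<open>E\<close> are joined.
\<close>

definition edge_weight :: "(real \<Rightarrow> real \<Rightarrow> real) \<Rightarrow> (nat \<times> nat) set \<Rightarrow> (nat \<Rightarrow> real) \<Rightarrow> real" where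
  "edge_weight W E x = (\<Prod>(a, b)\<in>E. W (x a) (x b))"

lemma measurable_edge_weight:
  assumes "graphon W" "E \<subseteq> V \<times> V"
  shows "edge_weight W E \<in> borel_measurable (\<Pi>\<^sub>M i\<in>V. unif01)"
  unfolding edge_weight_def using assms
  by (auto simp: case_prod_beta intro!: borel_measurable_prod measurable_graphon_coordinates)

lemma edge_weight_bounds:
  assumes "graphon W" "E \<subseteq> V \<times> V" "x \<in> space (\<Pi>\<^sub>M i\<in>V. unif01)"
  shows "0 \<le> edge_weight W E x" "edge_weight W E x \<le> 1"
proof -
  have "0 \<le> W (x a) (x b) \<and> W (x a) (x b) \<le> 1" if "(a, b) \<in> E" for a b
    using that assms graphon_bounds[OF assms(1), of "x a" "x b"] in_space_cube[OF assms(3)] by blast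
  then show "0 \<le> edge_weight W E x" "edge_weight W E x \<le> 1"
    unfolding edge_weight_def by (auto intro!: prod_nonneg prod_le_1)
qed

lemma integrable_edge_weight:
  assumes "graphon W" "E \<subseteq> V \<times> V"
  shows "integrable (\<Pi>\<^sub>M i\<in>V. unif01) (edge_weight W E)"
proof -
  interpret prob_space "\<Pi>\<^sub>M i\<in>V. unif01" by (rule prob_space_cube)
  show ?thesis
    using edge_weight_bounds[OF assms] measurable_edge_weight[OF assms]
    by (intro integrable_const_bound[where B = 1]) (auto intro!: AE_I2)
qed

section \<open>Probability that prescribed pairs are joined\<close>

definition latent_space :: "nat \<Rightarrow> ((nat \<Rightarrow> real) \<times> (nat \<times> nat \<Rightarrow> real)) measure" where
  "latent_space n = (\<Pi>\<^sub>M i\<in>{1..n}. unif01) \<Otimes>\<^sub>M (\<Pi>\<^sub>M p\<in>vertex_pairs n. unif01)"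

lemma finite_vertex_pairs: "finite (vertex_pairs n)"
  by (rule finite_subset[of _ "{1..n} \<times> {1..n}"]) (auto simp: vertex_pairs_def)

lemma prob_space_latent: "prob_space (latent_space n)"
proof -
  interpret U: prob_space "\<Pi>\<^sub>M i\<in>{1..n}. unif01" by (rule prob_space_cube)
  interpret Y: prob_space "\<Pi>\<^sub>M i\<in>vertex_pairs n. unif01" by (rule prob_space_cube)
  interpret pair_prob_space "\<Pi>\<^sub>M i\<in>{1..n}. unif01" "\<Pi>\<^sub>M i\<in>vertex_pairs n. unif01" ..
  show ?thesis unfolding latent_space_def by unfold_locales
qed

definition pairs_joined :: "nat \<Rightarrow> (real \<Rightarrow> real \<Rightarrow> real) \<Rightarrow> (nat \<times> nat) set \<Rightarrow>
    ((nat \<Rightarrow> real) \<times> (nat \<times> nat \<Rightarrow> real)) set" where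
  "pairs_joined n W E = {(U, Y) \<in> space (latent_space n). \<forall>(i, j)\<in>E. Y (i, j) \<le> W (U i) (U j)}"

lemma sets_pairs_joined:
  assumes "graphon W" "E \<subseteq> vertex_pairs n"
  shows "pairs_joined n W E \<in> sets (latent_space n)"
proof -
  have fin: "finite E" using assms(2) finite_vertex_pairs finite_subset by blast
  have [measurable]: "(\<lambda>\<omega>. W (fst \<omega> (fst p)) (fst \<omega> (snd p))) \<in> borel_measurable (latent_space n)"
      "(\<lambda>\<omega>. snd \<omega> p) \<in> borel_measurable (latent_space n)" if "p \<in> E" for p
  proof -
    have p: "p \<in> vertex_pairs n" "fst p \<in> {1..n}" "snd p \<in> {1..n}"
      using that assms(2) by (auto simp: vertex_pairs_def)
    show "(\<lambda>\<omega>. W (fst \<omega> (fst p)) (fst \<omega> (snd p))) \<in> borel_measurable (latent_space n)"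
      unfolding latent_space_def
      by (rule measurable_compose[OF measurable_fst measurable_graphon_coordinates[OF assms(1) p(2,3)]])
    have "(\<lambda>y. y p) \<in> borel_measurable (\<Pi>\<^sub>M p\<in>vertex_pairs n. unif01)"
      by (rule measurable_compose[OF measurable_component_singleton[OF p(1)] measurable_unif01_borel])
    then show "(\<lambda>\<omega>. snd \<omega> p) \<in> borel_measurable (latent_space n)"
      unfolding latent_space_def by (rule measurable_compose[OF measurable_snd])
  qed
  have "pairs_joined n W E
      = {\<omega> \<in> space (latent_space n). \<forall>p\<in>E. snd \<omega> p \<le> W (fst \<omega> (fst p)) (fst \<omega> (snd p))}"
    by (auto simp: pairs_joined_def)
  also have "\<dots> \<in> sets (latent_space n)"
    using fin by (intro sets.sets_Collect_finite_All borel_measurable_le) auto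
  finally show ?thesis .
qed

text \<open>
  For fixed \<open>U\<close> the event is a box in the space of the \<open>Y\<close>, with side \<open>{0..W (U i) (U j)}\<close> for
  each pair in \<open>E\<close> and the full interval for all others; its volume is then integrated over \<open>U\<close>.
\<close>

lemma prob_pairs_joined:
  assumes W: "graphon W" and E: "E \<subseteq> vertex_pairs n"
  shows "measure (latent_space n) (pairs_joined n W E)
    = (\<integral>x. edge_weight W E x \<partial>(\<Pi>\<^sub>M i\<in>{1..n}. unif01))"
proof -
  let ?U = "\<Pi>\<^sub>M i\<in>{1..n}. unif01" and ?Y = "\<Pi>\<^sub>M p\<in>vertex_pairs n. unif01"
  interpret L: prob_space "latent_space n" by (rule prob_space_latent)
  interpret U: prob_space ?U by (rule prob_space_cube)
  interpret Y: prob_space ?Y by (rule prob_space_cube)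
  interpret F: product_prob_space "\<lambda>_::nat\<times>nat. unif01" "vertex_pairs n"
    using prob_space_unif01 by (simp add: product_prob_space_def product_sigma_finite_def
        product_prob_space_axioms_def prob_space_imp_sigma_finite)
  have EV: "E \<subseteq> {1..n} \<times> {1..n}" using E by (auto simp: vertex_pairs_def)
  have slice: "emeasure ?Y (Pair x -` pairs_joined n W E) = ennreal (edge_weight W E x)"
    if x: "x \<in> space ?U" for x
  proof -
    define A where "A = (\<lambda>p. {y \<in> {0..1::real}. p \<in> E \<longrightarrow> y \<le> W (x (fst p)) (x (snd p))})"
    have bd: "0 \<le> W (x (fst p)) (x (snd p))" "W (x (fst p)) (x (snd p)) \<le> 1" if "p \<in> E" for p
      using that EV graphon_bounds[OF W in_space_cube[OF x] in_space_cube[OF x]] by auto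
    have A_in: "A p = {y \<in> {0..1}. y \<le> W (x (fst p)) (x (snd p))}" if "p \<in> E" for p
      using that by (simp add: A_def)
    have A_out: "A p = space unif01" if "p \<notin> E" for p
      using that by (auto simp: A_def)
    have A: "A p \<in> sets unif01" for p
      by (cases "p \<in> E") (simp_all only: A_in A_out sets.top not_False_eq_True emeasure_unif01_atMost(2)[OF bd])
    have eA: "emeasure unif01 (A p) = (if p \<in> E then ennreal (W (x (fst p)) (x (snd p))) else 1)" for p
      using emeasure_unif01_atMost(1)[OF bd] prob_space.emeasure_space_1[OF prob_space_unif01]
      by (cases "p \<in> E") (simp_all only: A_in A_out not_False_eq_True if_True if_False)
    have "Pair x -` pairs_joined n W E = Pi\<^sub>E (vertex_pairs n) A"
    proof (rule set_eqI)
      fix y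
      have "y \<in> Pair x -` pairs_joined n W E
          \<longleftrightarrow> y \<in> space ?Y \<and> (\<forall>p\<in>E. y p \<le> W (x (fst p)) (x (snd p)))"
        using x by (simp add: pairs_joined_def latent_space_def space_pair_measure case_prod_beta)
      also have "\<dots> \<longleftrightarrow> y \<in> Pi\<^sub>E (vertex_pairs n) A"
        unfolding space_PiM PiE_iff A_def space_unif01 using E by blast
      finally show "y \<in> Pair x -` pairs_joined n W E \<longleftrightarrow> y \<in> Pi\<^sub>E (vertex_pairs n) A" .
    qed
    then have "emeasure ?Y (Pair x -` pairs_joined n W E) = (\<Prod>p\<in>vertex_pairs n. emeasure unif01 (A p))"
      using F.emeasure_PiM[OF finite_vertex_pairs A] by simp
    also have "\<dots> = (\<Prod>p\<in>E. ennreal (W (x (fst p)) (x (snd p))))"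
      unfolding eA using E finite_vertex_pairs
      by (subst prod.inter_restrict[symmetric]) (auto simp: Int_absorb1)
    also have "\<dots> = ennreal (edge_weight W E x)"
      unfolding edge_weight_def case_prod_beta using bd by (intro prod_ennreal) auto
    finally show ?thesis .
  qed
  have "emeasure (latent_space n) (pairs_joined n W E) = (\<integral>\<^sup>+ x. emeasure ?Y (Pair x -` pairs_joined n W E) \<partial>?U)"
    using Y.emeasure_pair_measure_alt sets_pairs_joined[OF W E] unfolding latent_space_def by blast
  also have "\<dots> = (\<integral>\<^sup>+ x. ennreal (edge_weight W E x) \<partial>?U)"
    by (intro nn_integral_cong slice)
  also have "\<dots> = ennreal (\<integral>x. edge_weight W E x \<partial>?U)"
    using edge_weight_bounds(1)[OF W EV] by (intro nn_integral_eq_integral integrable_edge_weight[OF W EV] AE_I2)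
  finally show ?thesis
    using edge_weight_bounds(1)[OF W EV]
    by (simp add: L.emeasure_eq_measure Bochner_Integration.integral_nonneg)
qed

section \<open>Relabelling and independence of vertex types\<close>

lemma edge_weight_restrict:
  assumes "E \<subseteq> V \<times> V"
  shows "edge_weight W E (restrict x V) = edge_weight W E x"
  unfolding edge_weight_def using assms by (auto intro!: prod.cong)

lemma integral_edge_weight_reindex:
  assumes W: "graphon W" and E: "E \<subseteq> V \<times> V" and f: "inj_on f V" "f \<in> V \<rightarrow> I"
  shows "(\<integral>x. edge_weight W E (\<lambda>a\<in>V. x (f a)) \<partial>(\<Pi>\<^sub>M i\<in>I. unif01))
    = (\<integral>x. edge_weight W E x \<partial>(\<Pi>\<^sub>M a\<in>V. unif01))"
proof -
  have D: "distr (\<Pi>\<^sub>M i\<in>I. unif01) (\<Pi>\<^sub>M a\<in>V. unif01) (\<lambda>x. \<lambda>a\<in>V. x (f a)) = (\<Pi>\<^sub>M a\<in>V. unif01)"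
    using distr_PiM_reindex[of I "\<lambda>_. unif01" f V] f prob_space_unif01 by simp
  have meas: "(\<lambda>x. \<lambda>a\<in>V. x (f a)) \<in> measurable (\<Pi>\<^sub>M i\<in>I. unif01) (\<Pi>\<^sub>M a\<in>V. unif01)"
    using f(2) by (intro measurable_restrict measurable_component_singleton) auto
  show ?thesis
    using integral_distr[OF meas measurable_edge_weight[OF W E]] unfolding D by simp
qed

text \<open>
  Functions of disjoint blocks of independent coordinates are independent.
\<close>

lemma integral_edge_weight_disjoint:
  assumes W: "graphon W" and I: "finite I" and E: "E1 \<subseteq> V1 \<times> V1" "E2 \<subseteq> V2 \<times> V2"
    and V: "V1 \<subseteq> I" "V2 \<subseteq> I" "V1 \<inter> V2 = {}"
  shows "(\<integral>x. edge_weight W (E1 \<union> E2) x \<partial>(\<Pi>\<^sub>M i\<in>I. unif01))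
    = (\<integral>x. edge_weight W E1 x \<partial>(\<Pi>\<^sub>M i\<in>I. unif01)) * (\<integral>x. edge_weight W E2 x \<partial>(\<Pi>\<^sub>M i\<in>I. unif01))"
proof (cases "I = {}")
  case True
  then have "E1 = {}" "E2 = {}" using E V by auto
  then show ?thesis
    using prob_space.prob_space[OF prob_space_cube, of I] by (simp add: edge_weight_def)
next
  case False
  interpret P: prob_space "\<Pi>\<^sub>M i\<in>I. unif01" by (rule prob_space_cube)
  have E': "E1 \<subseteq> I \<times> I" "E2 \<subseteq> I \<times> I" using E V by auto
  have fin: "finite E1" "finite E2" using E' I by (meson finite_SigmaI finite_subset)+
  have "E1 \<inter> E2 = {}" using E V(3) by auto
  then have split: "edge_weight W (E1 \<union> E2) x = edge_weight W E1 x * edge_weight W E2 x" for x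
    using fin by (simp add: edge_weight_def prod.union_disjoint)
  have comp: "edge_weight W E \<circ> (\<lambda>x. restrict x V) = edge_weight W E" if "E \<subseteq> V \<times> V" for E V
    using edge_weight_restrict[OF that] by (auto simp: fun_eq_iff)
  have "P.indep_var borel (edge_weight W E1) borel (edge_weight W E2)"
    using P.indep_var_compose[OF P.indep_var_restrict[OF indep_vars_coordinates[OF False] V(3,1,2)]
        measurable_edge_weight[OF W E(1)] measurable_edge_weight[OF W E(2)]]
      comp[OF E(1)] comp[OF E(2)] by simp
  then show ?thesis
    unfolding split using integrable_edge_weight[OF W] E' by (intro P.indep_var_lebesgue_integral) auto
qed

section \<open>Homomorphisms into the random graph\<close>

definition oriented_edges :: "graph \<Rightarrow> (nat \<times> nat) set" where
  "oriented_edges H = {(a, b). a < b \<and> {a, b} \<in> edges H}"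

text \<open>
  The pairs, increasingly ordered to index the family \<open>Y\<close>, that must be joined for \<open>f\<close> to be a
  homomorphism.
\<close>

definition image_pairs :: "(nat \<Rightarrow> nat) \<Rightarrow> graph \<Rightarrow> (nat \<times> nat) set" where
  "image_pairs f H = (\<lambda>(a, b). (min (f a) (f b), max (f a) (f b))) ` oriented_edges H"

lemma oriented_edges_subset: "simple_graph H \<Longrightarrow> oriented_edges H \<subseteq> verts H \<times> verts H"
  by (auto simp: oriented_edges_def dest!: edges_subset_verts)

lemma hom_density_edge_weight:
  "hom_density H W = (\<integral>x. edge_weight W (oriented_edges H) x \<partial>(\<Pi>\<^sub>M a\<in>verts H. unif01))"
  by (simp add: hom_density_def edge_weight_def oriented_edges_def)

lemma edge_obtain_oriented:
  assumes "simple_graph H" "e \<in> edges H"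
  obtains a b where "e = {a, b}" "(a, b) \<in> oriented_edges H"
proof -
  have "card e = 2" using assms by (auto simp: simple_graph_def)
  then obtain a b where "e = {a, b}" "a \<noteq> b" by (auto simp: card_2_iff)
  then show thesis
    using assms(2) that[of "min a b" "max a b"]
    by (cases "a < b") (auto simp: oriented_edges_def min_def max_def insert_commute)
qed

lemma image_pairs_subset:
  assumes H: "simple_graph H" and f: "f \<in> injections (verts H) {1..n}"
  shows "image_pairs f H \<subseteq> vertex_pairs n"
    and "image_pairs f H \<subseteq> f ` verts H \<times> f ` verts H"
proof -
  have *: "a \<in> verts H \<and> b \<in> verts H \<and> f a \<in> {1..n} \<and> f b \<in> {1..n} \<and> f a \<noteq> f b"
    if "(a, b) \<in> oriented_edges H" for a b
  proof -
    have ab: "a \<in> verts H" "b \<in> verts H" "a \<noteq> b"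
      using that oriented_edges_subset[OF H] by (auto simp: oriented_edges_def)
    then show ?thesis
      using f by (auto simp: injections_def inj_on_def)
  qed
  show "image_pairs f H \<subseteq> vertex_pairs n"
    using * by (fastforce simp: image_pairs_def vertex_pairs_def min_def max_def)
  show "image_pairs f H \<subseteq> f ` verts H \<times> f ` verts H"
    using * by (fastforce simp: image_pairs_def min_def max_def)
qed

text \<open>
  Injectivity of \<open>f\<close> keeps the images of distinct edges distinct, so that both products have the same
  factors, and symmetry of \<open>W\<close> absorbs the reordering of the endpoints.
\<close>

lemma edge_weight_image_pairs:
  assumes W: "graphon W" and H: "simple_graph H" and f: "f \<in> injections (verts H) {1..n}"
    and x: "x \<in> space (\<Pi>\<^sub>M i\<in>{1..n}. unif01)"
  shows "edge_weight W (image_pairs f H) x = edge_weight W (oriented_edges H) (\<lambda>a\<in>verts H. x (f a))"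
proof -
  have fH: "inj_on f (verts H)" "f \<in> verts H \<rightarrow> {1..n}" using f by (auto simp: injections_def)
  have inV: "a \<in> verts H" "b \<in> verts H" if "(a, b) \<in> oriented_edges H" for a b
    using that oriented_edges_subset[OF H] by auto
  have "inj_on (\<lambda>(a, b). (min (f a) (f b), max (f a) (f b))) (oriented_edges H)"
  proof (rule inj_onI, clarify)
    fix a b c d
    assume ab: "(a, b) \<in> oriented_edges H" and cd: "(c, d) \<in> oriented_edges H"
      and eq: "min (f a) (f b) = min (f c) (f d)" "max (f a) (f b) = max (f c) (f d)"
    have "f a = f c \<and> f b = f d \<or> f a = f d \<and> f b = f c"
      using eq by (auto simp: min_def max_def split: if_splits)
    then have "a = c \<and> b = d \<or> a = d \<and> b = c"
      using fH(1) inV[OF ab] inV[OF cd] by (auto simp: inj_on_def)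
    then show "a = c \<and> b = d" using ab cd by (auto simp: oriented_edges_def)
  qed
  moreover have "W (x (min (f a) (f b))) (x (max (f a) (f b))) = W (x (f a)) (x (f b))"
    if "(a, b) \<in> oriented_edges H" for a b
  proof -
    have "f a \<in> {1..n}" "f b \<in> {1..n}" using inV[OF that] fH(2) by auto
    then show ?thesis
      using graphon_bounds(1)[OF W in_space_cube[OF x] in_space_cube[OF x]]
      by (simp add: min_def max_def)
  qed
  ultimately show ?thesis
    unfolding edge_weight_def image_pairs_def
    by (subst prod.reindex) (auto intro!: prod.cong simp: inV)
qed

lemma edge_threshold_graph:
  assumes "(i, j) \<in> vertex_pairs n"
  shows "{i, j} \<in> edges (threshold_graph n W U Y) \<longleftrightarrow> Y (i, j) \<le> W (U i) (U j)"
  using assms by (auto simp: threshold_graph_def vertex_pairs_def doubleton_eq_iff)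

lemma threshold_graph_simple: "threshold_graph n W U Y \<in> simple_graphs_on {1..n}"
  by (auto simp: threshold_graph_def simple_graphs_on_def simple_graph_def vertex_pairs_def)

lemma injective_hom_threshold_graph:
  assumes H: "simple_graph H" and f: "f \<in> injections (verts H) {1..n}"
  shows "f \<in> injective_homs H (threshold_graph n W U Y)
    \<longleftrightarrow> (\<forall>(i, j)\<in>image_pairs f H. Y (i, j) \<le> W (U i) (U j))"
proof -
  have V: "verts (threshold_graph n W U Y) = {1..n}" by (simp add: threshold_graph_def)
  have pair: "f ` {a, b} \<in> edges (threshold_graph n W U Y)
      \<longleftrightarrow> Y (min (f a) (f b), max (f a) (f b)) \<le> W (U (min (f a) (f b))) (U (max (f a) (f b)))"
    if "(a, b) \<in> oriented_edges H" for a b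
  proof -
    have "(min (f a) (f b), max (f a) (f b)) \<in> vertex_pairs n"
      using image_pairs_subset(1)[OF H f] that by (auto simp: image_pairs_def)
    moreover have "f ` {a, b} = {min (f a) (f b), max (f a) (f b)}" by (auto simp: min_def max_def)
    ultimately show ?thesis using edge_threshold_graph by simp
  qed
  have "(\<forall>e\<in>edges H. f ` e \<in> edges (threshold_graph n W U Y))
      \<longleftrightarrow> (\<forall>(a, b)\<in>oriented_edges H. f ` {a, b} \<in> edges (threshold_graph n W U Y))"
  proof (intro iffI ballI)
    fix e
    assume R: "\<forall>(a, b)\<in>oriented_edges H. f ` {a, b} \<in> edges (threshold_graph n W U Y)"
      and e: "e \<in> edges H"
    obtain a b where "e = {a, b}" "(a, b) \<in> oriented_edges H" using edge_obtain_oriented[OF H e] .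
    then show "f ` e \<in> edges (threshold_graph n W U Y)" using R by blast
  qed (auto simp: oriented_edges_def)
  also have "\<dots> \<longleftrightarrow> (\<forall>(i, j)\<in>image_pairs f H. Y (i, j) \<le> W (U i) (U j))"
    using pair by (auto simp: image_pairs_def)
  finally show ?thesis using f by (simp add: injective_homs_def V)
qed

lemma finite_simple_graphs_on:
  assumes "finite V"
  shows "finite (simple_graphs_on V)"
proof (rule finite_subset)
  show "simple_graphs_on V \<subseteq> Graph V ` Pow (Pow V)"
  proof
    fix G assume "G \<in> simple_graphs_on V"
    then have "G = Graph V (edges G)" "edges G \<in> Pow (Pow V)"
      by (cases G; auto simp: simple_graphs_on_def simple_graph_def)+
    then show "G \<in> Graph V ` Pow (Pow V)" by blast
  qed
qed (use assms in simp)

text \<open>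
  The target is finite, so only fibres matter; the fibre of a graph \<open>S\<close> prescribes for each of the
  finitely many vertex pairs whether it is joined.
\<close>

lemma measurable_threshold_graph:
  assumes W: "graphon W"
  shows "(\<lambda>(U, Y). threshold_graph n W U Y)
    \<in> measurable (latent_space n) (count_space (simple_graphs_on {1..n}))"
proof (subst measurable_count_space_eq2)
  show "finite (simple_graphs_on {1..n})" by (simp add: finite_simple_graphs_on)
  let ?T = "\<lambda>(U, Y). threshold_graph n W U Y"
  have "?T -` {S} \<inter> space (latent_space n) \<in> sets (latent_space n)" if S: "S \<in> simple_graphs_on {1..n}" for S
  proof -
    have iff: "threshold_graph n W U Y = S
        \<longleftrightarrow> (\<forall>(i, j)\<in>vertex_pairs n. Y (i, j) \<le> W (U i) (U j) \<longleftrightarrow> {i, j} \<in> edges S)" for U Y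
    proof
      assume R: "\<forall>(i, j)\<in>vertex_pairs n. Y (i, j) \<le> W (U i) (U j) \<longleftrightarrow> {i, j} \<in> edges S"
      have sub: "edges S \<subseteq> {{i, j} | i j. (i, j) \<in> vertex_pairs n}"
      proof
        fix e assume e: "e \<in> edges S"
        have S': "simple_graph S" "verts S = {1..n}" using S by (auto simp: simple_graphs_on_def)
        obtain a b where "e = {a, b}" "(a, b) \<in> oriented_edges S"
          using edge_obtain_oriented[OF S'(1) e] .
        then have "e = {a, b}" "a < b" "e \<subseteq> {1..n}"
          using edges_subset_verts[OF S'(1) e] S'(2) by (auto simp: oriented_edges_def)
        then show "e \<in> {{i, j} | i j. (i, j) \<in> vertex_pairs n}" by (auto simp: vertex_pairs_def)
      qed
      have "edges (threshold_graph n W U Y) = edges S"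
      proof (rule set_eqI)
        fix e
        show "e \<in> edges (threshold_graph n W U Y) \<longleftrightarrow> e \<in> edges S"
        proof (cases "\<exists>i j. e = {i, j} \<and> (i, j) \<in> vertex_pairs n")
          case True
          then show ?thesis using R edge_threshold_graph by blast
        next
          case False
          have "e \<notin> edges (threshold_graph n W U Y)" using False unfolding threshold_graph_def graph.sel by blast
          moreover have "e \<notin> edges S" using False sub by blast
          ultimately show ?thesis by simp
        qed
      qed
      then show "threshold_graph n W U Y = S"
        using S by (intro graph.expand) (simp add: threshold_graph_def simple_graphs_on_def)
    qed (auto simp: edge_threshold_graph)
    have "?T -` {S} \<inter> space (latent_space n)
        = {\<omega> \<in> space (latent_space n). \<forall>p\<in>vertex_pairs n.
            \<omega> \<in> pairs_joined n W {p} \<longleftrightarrow> {fst p, snd p} \<in> edges S}"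
    proof (rule set_eqI)
      fix \<omega> :: "(nat \<Rightarrow> real) \<times> (nat \<times> nat \<Rightarrow> real)"
      obtain U Y where \<omega>: "\<omega> = (U, Y)" by (cases \<omega>)
      have "\<omega> \<in> pairs_joined n W {p} \<longleftrightarrow> Y p \<le> W (U (fst p)) (U (snd p))"
        if "\<omega> \<in> space (latent_space n)" for p
        using that by (simp add: pairs_joined_def case_prod_beta \<omega>)
      then show "\<omega> \<in> ?T -` {S} \<inter> space (latent_space n) \<longleftrightarrow> \<omega> \<in> {\<omega> \<in> space (latent_space n).
          \<forall>p\<in>vertex_pairs n. \<omega> \<in> pairs_joined n W {p} \<longleftrightarrow> {fst p, snd p} \<in> edges S}"
        using iff[of U Y] by (auto simp add: case_prod_beta \<omega>)
    qed
    also have "\<dots> \<in> sets (latent_space n)"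
    proof (rule sets.sets_Collect_finite_All[OF _ finite_vertex_pairs])
      fix p assume "p \<in> vertex_pairs n"
      then have "pairs_joined n W {p} \<in> sets (latent_space n)" by (intro sets_pairs_joined W) auto
      then show "{\<omega> \<in> space (latent_space n). \<omega> \<in> pairs_joined n W {p} \<longleftrightarrow> {fst p, snd p} \<in> edges S}
          \<in> sets (latent_space n)"
        by measurable
    qed
    finally show ?thesis .
  qed
  then show "?T \<in> space (latent_space n) \<rightarrow> simple_graphs_on {1..n} \<and>
      (\<forall>a\<in>simple_graphs_on {1..n}. ?T -` {a} \<inter> space (latent_space n) \<in> sets (latent_space n))"
    using threshold_graph_simple by auto
qed

lemma W_random_graph_distr:
  "W_random_graph n W = distr (latent_space n) (count_space (simple_graphs_on {1..n}))
     (\<lambda>(U, Y). threshold_graph n W U Y)"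
  by (simp add: W_random_graph_def latent_space_def)

lemma space_W_random_graph [simp]: "space (W_random_graph n W) = simple_graphs_on {1..n}"
  and sets_W_random_graph [simp]: "sets (W_random_graph n W) = Pow (simple_graphs_on {1..n})"
  by (simp_all add: W_random_graph_def)

lemma prob_space_W_random_graph: "graphon W \<Longrightarrow> prob_space (W_random_graph n W)"
  unfolding W_random_graph_distr
  by (rule prob_space.prob_space_distr[OF prob_space_latent measurable_threshold_graph])

lemma measure_W_random_graph:
  assumes "graphon W" "A \<subseteq> simple_graphs_on {1..n}"
  shows "measure (W_random_graph n W) A
    = measure (latent_space n) {(U, Y) \<in> space (latent_space n). threshold_graph n W U Y \<in> A}"
  unfolding W_random_graph_distr using assms
  by (subst measure_distr[OF measurable_threshold_graph]) (auto intro!: arg_cong[where f = "measure _"])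

lemma integral_edge_weight_image_pairs:
  assumes W: "graphon W" and H: "simple_graph H" and f: "f \<in> injections (verts H) {1..n}"
  shows "(\<integral>x. edge_weight W (image_pairs f H) x \<partial>(\<Pi>\<^sub>M i\<in>{1..n}. unif01)) = hom_density H W"
proof -
  have fH: "inj_on f (verts H)" "f \<in> verts H \<rightarrow> {1..n}" using f by (auto simp: injections_def)
  show ?thesis
    unfolding hom_density_edge_weight
      integral_edge_weight_reindex[OF W oriented_edges_subset[OF H] fH, symmetric]
    by (rule Bochner_Integration.integral_cong) (simp_all only: edge_weight_image_pairs[OF W H f])
qed

lemma prob_injective_hom:
  assumes W: "graphon W" and H: "simple_graph H" and f: "f \<in> injections (verts H) {1..n}"
  shows "measure (W_random_graph n W) {G \<in> simple_graphs_on {1..n}. f \<in> injective_homs H G}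
    = hom_density H W"
proof -
  have "{(U, Y) \<in> space (latent_space n). threshold_graph n W U Y \<in> {G \<in> simple_graphs_on {1..n}. f \<in> injective_homs H G}}
      = pairs_joined n W (image_pairs f H)"
    using injective_hom_threshold_graph[OF H f] threshold_graph_simple by (auto simp: pairs_joined_def)
  then show ?thesis
    by (simp only: measure_W_random_graph[OF W] prob_pairs_joined[OF W image_pairs_subset(1)[OF H f]]
        integral_edge_weight_image_pairs[OF W H f] Collect_restrict)
qed

text \<open>
  Disjoint images mean that the two families of prescribed pairs involve disjoint sets of vertices.
\<close>

lemma prob_two_injective_homs:
  assumes W: "graphon W" and H: "simple_graph H"
    and f: "f \<in> injections (verts H) {1..n}" and g: "g \<in> injections (verts H) {1..n}"
    and disj: "f ` verts H \<inter> g ` verts H = {}"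
  shows "measure (W_random_graph n W)
      {G \<in> simple_graphs_on {1..n}. f \<in> injective_homs H G \<and> g \<in> injective_homs H G}
    = (hom_density H W)\<^sup>2"
proof -
  let ?E = "image_pairs f H \<union> image_pairs g H"
  have E: "?E \<subseteq> vertex_pairs n" using image_pairs_subset(1)[OF H] f g by auto
  have into: "f ` verts H \<subseteq> {1..n}" "g ` verts H \<subseteq> {1..n}" using f g by (auto simp: injections_def)
  have "{(U, Y) \<in> space (latent_space n). threshold_graph n W U Y \<in>
        {G \<in> simple_graphs_on {1..n}. f \<in> injective_homs H G \<and> g \<in> injective_homs H G}}
      = pairs_joined n W ?E"
    using injective_hom_threshold_graph[OF H f] injective_hom_threshold_graph[OF H g]
      threshold_graph_simple unfolding pairs_joined_def ball_Un by blast
  then show ?thesis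
    by (simp only: measure_W_random_graph[OF W] prob_pairs_joined[OF W E] Collect_restrict
      integral_edge_weight_disjoint[OF W finite_atLeastAtMost image_pairs_subset(2)[OF H f]
          image_pairs_subset(2)[OF H g] into disj]
      integral_edge_weight_image_pairs[OF W H f] integral_edge_weight_image_pairs[OF W H g] power2_eq_square)
qed

section \<open>A weak law of large numbers for empirical densities\<close>

text \<open>
  When the second moment of the average is expanded into pairs, only the pairs in \<open>B\<close> can contribute
  more than \<open>t\<^sup>2\<close>, and each of them contributes at most \<open>1\<close>.  Hence the variance is at most
  \<open>card B / (card I)\<^sup>2\<close>, and Chebyshev's inequality applies.
\<close>

lemma (in prob_space) weak_law_sparse_dependence:
  fixes A :: "'i \<Rightarrow> 'a set"
  assumes I: "finite I" "I \<noteq> {}" and ev: "\<And>f. f \<in> I \<Longrightarrow> A f \<in> events"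
    and t: "\<And>f. f \<in> I \<Longrightarrow> prob (A f) = t"
    and B: "B \<subseteq> I \<times> I"
    and uncorr: "\<And>f g. f \<in> I \<Longrightarrow> g \<in> I \<Longrightarrow> (f, g) \<notin> B \<Longrightarrow> prob (A f \<inter> A g) = t\<^sup>2"
    and a: "a > 0"
  shows "prob {x \<in> space M. a \<le> \<bar>(\<Sum>f\<in>I. indicator (A f) x) / real (card I) - t\<bar>}
    \<le> real (card B) / (real (card I))\<^sup>2 / a\<^sup>2"
proof -
  define N where "N = real (card I)"
  define X where "X = (\<lambda>x. (\<Sum>f\<in>I. indicator (A f) x :: real) / N)"
  have N: "N > 0" using I by (simp add: N_def card_gt_0_iff)
  have [simp]: "integrable M (\<lambda>x. indicator (A f) x :: real)" if "f \<in> I" for f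
    using ev[OF that] by (simp add: integrable_indicator_iff emeasure_eq_measure)
  have [simp]: "integrable M (\<lambda>x. indicator (A f \<inter> A g) x :: real)" if "f \<in> I" "g \<in> I" for f g
    using ev that by (simp add: integrable_indicator_iff emeasure_eq_measure sets.Int)
  have X2: "(X x)\<^sup>2 = (\<Sum>f\<in>I. \<Sum>g\<in>I. indicator (A f \<inter> A g) x) / N\<^sup>2" for x
    by (simp add: X_def power_divide power2_eq_square sum_product indicator_inter_arith)
  have int: "integrable M X" "integrable M (\<lambda>x. (X x)\<^sup>2)"
    unfolding X2 unfolding X_def by (auto intro!: Bochner_Integration.integrable_sum)
  have "expectation X = (\<Sum>f\<in>I. prob (A f)) / N"
    using ev by (simp add: X_def Bochner_Integration.integral_sum)
  then have EX: "expectation X = t" using t N by (simp add: N_def)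
  have "expectation (\<lambda>x. (X x)\<^sup>2) = (\<Sum>f\<in>I. \<Sum>g\<in>I. prob (A f \<inter> A g)) / N\<^sup>2"
    unfolding X2 using ev by (simp add: Bochner_Integration.integral_sum sets.Int)
  also have "\<dots> \<le> (\<Sum>f\<in>I. \<Sum>g\<in>I. t\<^sup>2 + indicator B (f, g)) / N\<^sup>2"
  proof (intro divide_right_mono sum_mono)
    fix f g assume "f \<in> I" "g \<in> I"
    then show "prob (A f \<inter> A g) \<le> t\<^sup>2 + indicator B (f, g)"
      using uncorr[of f g] prob_le_1[of "A f \<inter> A g"] zero_le_power2[of t]
      by (cases "(f, g) \<in> B") (simp_all add: add_increasing)
  qed simp
  also have "(\<Sum>f\<in>I. \<Sum>g\<in>I. t\<^sup>2 + indicator B (f, g)) = N\<^sup>2 * t\<^sup>2 + real (card B)"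
  proof -
    have "(\<Sum>p\<in>I \<times> I. indicator B p :: real) = real (card B)"
      using B I(1) by (simp add: indicator_def sum.If_cases Int_absorb1)
    then show ?thesis
      by (simp add: sum.distrib sum.cartesian_product N_def power2_eq_square)
  qed
  finally have "expectation (\<lambda>x. (X x)\<^sup>2) \<le> t\<^sup>2 + real (card B) / N\<^sup>2"
    using N by (simp add: add_divide_distrib)
  then have "variance X \<le> real (card B) / N\<^sup>2"
    using variance_eq[OF int] EX by simp
  moreover have "prob {x \<in> space M. a \<le> \<bar>X x - t\<bar>} \<le> variance X / a\<^sup>2"
    using Chebyshev_inequality[OF _ int(2) a] int(1) EX by (simp add: borel_measurable_integrable)
  ultimately show ?thesis
    using divide_right_mono[of "variance X" "real (card B) / N\<^sup>2" "a\<^sup>2"] by (simp add: X_def N_def)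
qed

lemma falling_factorial_pos: "k \<le> n \<Longrightarrow> falling_factorial n k > 0"
  unfolding falling_factorial_def by (intro prod_pos) auto

lemma falling_factorial_ge: "2 * k \<le> n \<Longrightarrow> (real n / 2) ^ k \<le> falling_factorial n k"
proof -
  assume k: "2 * k \<le> n"
  have "(\<Prod>i<k. real n / 2) \<le> (\<Prod>i<k. real n - real i)"
  proof (intro prod_mono conjI)
    fix i assume "i \<in> {..<k}"
    then have "2 * i \<le> n" using k by simp
    then have "2 * real i \<le> real n" by linarith
    then show "real n / 2 \<le> real n - real i" by simp
  qed simp
  then show ?thesis by (simp add: falling_factorial_def)
qed

lemma card_injections:
  assumes "finite V" "card V \<le> n"
  shows "real (card (injections V {1..n})) = falling_factorial n (card V)"
proof -
  have "card (injections V {1..n}) = (\<Prod>i<card V. n - i)"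
    using card_inj_on_subset_funcset[of V "{1..n}" V] assms
    by (simp add: injections_def atLeast0LessThan)
  then show ?thesis
    using assms(2) by (auto simp: falling_factorial_def of_nat_diff intro!: prod.cong)
qed

lemma card_PiE_fixed_value:
  assumes "finite V" "b \<in> V"
  shows "card {g \<in> V \<rightarrow>\<^sub>E {1..n::nat}. g b = v} \<le> n ^ (card V - 1)"
proof -
  have "{g \<in> V \<rightarrow>\<^sub>E {1..n}. g b = v} \<subseteq> Pi\<^sub>E V (\<lambda>c. if c = b then {v} else {1..n})"
    by (auto simp: PiE_iff extensional_def)
  then have "card {g \<in> V \<rightarrow>\<^sub>E {1..n}. g b = v} \<le> card (Pi\<^sub>E V (\<lambda>c. if c = b then {v} else {1..n}))"
    using assms by (intro card_mono finite_PiE) auto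
  also have "\<dots> = (\<Prod>c\<in>V. card (if c = b then {v} else {1..n}))"
    using assms by (intro card_PiE)
  also have "\<dots> = (\<Prod>c\<in>V - {b}. n)"
    using assms by (subst prod.remove[of _ b]) (auto intro!: prod.cong)
  also have "\<dots> = n ^ (card V - 1)" using assms by simp
  finally show ?thesis .
qed

definition overlapping_pairs :: "nat set \<Rightarrow> nat \<Rightarrow> ((nat \<Rightarrow> nat) \<times> (nat \<Rightarrow> nat)) set" where
  "overlapping_pairs V n =
     (SIGMA f:injections V {1..n}. {g \<in> injections V {1..n}. f ` V \<inter> g ` V \<noteq> {}})"

text \<open>
  For given \<open>f\<close>, an overlap means \<open>g b = f a\<close> for one of \<open>(card V)\<^sup>2\<close> pairs \<open>(a, b)\<close>, which leaves
  \<open>card V - 1\<close> values of \<open>g\<close> to be chosen.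
\<close>

lemma card_overlapping_pairs:
  assumes V: "finite V"
  shows "card (overlapping_pairs V n)
    \<le> card (injections V {1..n}) * ((card V)\<^sup>2 * n ^ (card V - 1))"
proof -
  let ?I = "injections V {1..n}"
  have fin: "finite ?I" using finite_injections V by simp
  have "card {g \<in> ?I. f ` V \<inter> g ` V \<noteq> {}} \<le> (card V)\<^sup>2 * n ^ (card V - 1)" for f
  proof -
    let ?S = "\<lambda>a b. {g \<in> V \<rightarrow>\<^sub>E {1..n}. g b = f a}"
    have finS: "finite (?S a b)" for a b
      using V by (intro finite_subset[OF _ finite_PiE[of V "\<lambda>_. {1..n}"]]) auto
    have "{g \<in> ?I. f ` V \<inter> g ` V \<noteq> {}} \<subseteq> (\<Union>a\<in>V. \<Union>b\<in>V. ?S a b)"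
      by (fastforce simp: injections_def)
    then have "card {g \<in> ?I. f ` V \<inter> g ` V \<noteq> {}} \<le> card (\<Union>a\<in>V. \<Union>b\<in>V. ?S a b)"
      using V finS by (intro card_mono) auto
    also have "\<dots> \<le> (\<Sum>a\<in>V. card (\<Union>b\<in>V. ?S a b))"
      using V by (rule card_UN_le)
    also have "\<dots> \<le> (\<Sum>a\<in>V. \<Sum>b\<in>V. card (?S a b))"
      using V by (intro sum_mono card_UN_le)
    also have "\<dots> \<le> (\<Sum>a\<in>V. \<Sum>b\<in>V. n ^ (card V - 1))"
      using card_PiE_fixed_value[OF V] by (intro sum_mono)
    finally show ?thesis by (simp add: power2_eq_square)
  qed
  then have "(\<Sum>f\<in>?I. card {g \<in> ?I. f ` V \<inter> g ` V \<noteq> {}}) \<le> (\<Sum>f\<in>?I. (card V)\<^sup>2 * n ^ (card V - 1))"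
    by (intro sum_mono)
  then show ?thesis unfolding overlapping_pairs_def using fin by (subst card_SigmaI) auto
qed

text \<open>
  Of order \<open>1 / n\<close>, because fixing one value of \<open>g\<close> loses a factor \<open>n\<close> against the at least
  \<open>(n / 2) ^ card V\<close> injections.
\<close>

lemma overlapping_pairs_fraction:
  assumes V: "finite V" and n: "2 * card V \<le> n" "0 < n"
  shows "real (card (overlapping_pairs V n)) / (real (card (injections V {1..n})))\<^sup>2
    \<le> (real (card V))\<^sup>2 * 2 ^ card V / real n"
proof (cases "V = {}")
  case True
  then show ?thesis by (simp add: overlapping_pairs_def)
next
  case False
  define k where "k = card V"
  define N where "N = real (card (injections V {1..n}))"
  have k: "k = Suc (k - 1)" using False V by (simp add: k_def card_gt_0_iff)
  have NF: "N = falling_factorial n k" using card_injections[OF V] n by (simp add: N_def k_def)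
  have Nge: "(real n / 2) ^ k \<le> N" using falling_factorial_ge n by (simp add: NF k_def)
  have "(real n / 2) ^ k > 0" using n by simp
  then have Npos: "N > 0" using Nge by linarith
  have "real (card (overlapping_pairs V n)) \<le> N * ((real k)\<^sup>2 * real n ^ (k - 1))"
    using card_overlapping_pairs[OF V, of n] unfolding N_def k_def
    by (metis of_nat_le_iff of_nat_mult of_nat_power)
  then have "real (card (overlapping_pairs V n)) / N\<^sup>2 \<le> (N * ((real k)\<^sup>2 * real n ^ (k - 1))) / N\<^sup>2"
    by (intro divide_right_mono) auto
  also have "\<dots> = (real k)\<^sup>2 * real n ^ (k - 1) / N"
    using Npos by (simp add: power2_eq_square)
  also have "\<dots> \<le> (real k)\<^sup>2 * real n ^ (k - 1) / (real n / 2) ^ k"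
    using Nge n Npos by (intro divide_left_mono mult_pos_pos) auto
  also have "\<dots> = (real k)\<^sup>2 * 2 ^ k / real n"
    using n by (subst (2) k, subst (3) k) (simp add: power_divide field_simps)
  finally show ?thesis by (simp add: N_def k_def)
qed

lemma simple_graphs_on_D:
  "G \<in> simple_graphs_on V \<Longrightarrow> simple_graph G" "G \<in> simple_graphs_on V \<Longrightarrow> verts G = V"
  by (simp_all add: simple_graphs_on_def)

lemma empirical_density_injective_homs:
  assumes H: "simple_graph H" and n: "card (verts H) \<le> n" and G: "G \<in> simple_graphs_on {1..n}"
  shows "empirical_density H G
    = real (card (injective_homs H G)) / real (card (injections (verts H) {1..n}))"
proof -
  have "finite (verts H)" using H by (simp add: simple_graph_def)
  then show ?thesis
    using card_injective_homs[OF H simple_graphs_on_D(1)[OF G]] simple_graphs_on_D(2)[OF G]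
      card_injections[OF _ n]
    by (simp add: empirical_density_def)
qed

lemma empirical_density_concentration:
  assumes W: "graphon W" and H: "simple_graph H" and n: "2 * card (verts H) \<le> n" "0 < n" and a: "a > 0"
  shows "measure (W_random_graph n W)
      {G \<in> simple_graphs_on {1..n}. a \<le> \<bar>empirical_density H G - hom_density H W\<bar>}
    \<le> (real (card (verts H)))\<^sup>2 * 2 ^ card (verts H) / real n / a\<^sup>2"
proof -
  let ?V = "verts H" and ?t = "hom_density H W"
  let ?I = "injections ?V {1..n}"
  interpret R: prob_space "W_random_graph n W" by (rule prob_space_W_random_graph[OF W])
  have V: "finite ?V" using H by (simp add: simple_graph_def)
  have fin: "finite ?I" using finite_injections V by simp
  have kn: "card ?V \<le> n" using n by simp
  have ne: "?I \<noteq> {}" using falling_factorial_pos[OF kn] card_injections[OF V kn] by auto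
  define A where "A f = {G \<in> simple_graphs_on {1..n}. f \<in> injective_homs H G}" for f
  have dens: "empirical_density H G = (\<Sum>f\<in>?I. indicator (A f) G) / real (card ?I)"
    if G: "G \<in> simple_graphs_on {1..n}" for G
  proof -
    have "injective_homs H G = {f \<in> ?I. G \<in> A f}"
      using G simple_graphs_on_D(2)[OF G] by (auto simp: A_def injective_homs_def)
    then have "real (card (injective_homs H G)) = (\<Sum>f\<in>?I. indicator (A f) G)"
      using fin by (simp add: indicator_def sum.If_cases Int_def)
    then show ?thesis using empirical_density_injective_homs[OF H kn G] by simp
  qed
  have "measure (W_random_graph n W)
      {G \<in> simple_graphs_on {1..n}. a \<le> \<bar>empirical_density H G - ?t\<bar>}
    = R.prob {G \<in> space (W_random_graph n W). a \<le> \<bar>(\<Sum>f\<in>?I. indicator (A f) G) / real (card ?I) - ?t\<bar>}"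
    using dens by (intro arg_cong[where f = R.prob]) auto
  also have "\<dots> \<le> real (card (overlapping_pairs ?V n)) / (real (card ?I))\<^sup>2 / a\<^sup>2"
  proof (rule R.weak_law_sparse_dependence[OF fin ne _ _ _ _ a])
    show "A f \<in> R.events" for f by (auto simp: A_def)
    show "R.prob (A f) = ?t" if "f \<in> ?I" for f
      unfolding A_def by (rule prob_injective_hom[OF W H that])
    show "overlapping_pairs ?V n \<subseteq> ?I \<times> ?I" by (auto simp: overlapping_pairs_def)
    fix f g assume f: "f \<in> ?I" and g: "g \<in> ?I" and "(f, g) \<notin> overlapping_pairs ?V n"
    then have disj: "f ` ?V \<inter> g ` ?V = {}" by (auto simp: overlapping_pairs_def)
    have "A f \<inter> A g = {G \<in> simple_graphs_on {1..n}. f \<in> injective_homs H G \<and> g \<in> injective_homs H G}"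
      by (auto simp: A_def)
    then show "R.prob (A f \<inter> A g) = ?t\<^sup>2" using prob_two_injective_homs[OF W H f g disj] by simp
  qed
  also have "\<dots> \<le> (real (card ?V))\<^sup>2 * 2 ^ card ?V / real n / a\<^sup>2"
    using overlapping_pairs_fraction[OF V n] by (rule divide_right_mono) simp
  finally show ?thesis .
qed

section \<open>Edgeless and complete graphs\<close>

lemma hom_density_bounds:
  assumes W: "graphon W" and H: "simple_graph H"
  shows "0 \<le> hom_density H W" "hom_density H W \<le> 1"
proof -
  interpret prob_space "\<Pi>\<^sub>M a\<in>verts H. unif01" by (rule prob_space_cube)
  note E = oriented_edges_subset[OF H]
  show "0 \<le> hom_density H W" "hom_density H W \<le> 1"
    unfolding hom_density_edge_weight
    using edge_weight_bounds[OF W E]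
    by (auto intro!: integral_ge_const integral_le_const integrable_edge_weight[OF W E] AE_I2)
qed

lemma injective_homs_subset:
  "G \<in> simple_graphs_on {1..n} \<Longrightarrow> injective_homs H G \<subseteq> injections (verts H) {1..n}"
  by (auto simp: injective_homs_def simple_graphs_on_D(2))

lemma empirical_density_bounds:
  assumes "simple_graph H" "card (verts H) \<le> n" "G \<in> simple_graphs_on {1..n}"
  shows "0 \<le> empirical_density H G" "empirical_density H G \<le> 1"
proof -
  have "finite (verts H)" using assms(1) by (simp add: simple_graph_def)
  then have "card (injective_homs H G) \<le> card (injections (verts H) {1..n})"
    using injective_homs_subset[OF assms(3)] finite_injections by (intro card_mono) auto
  then show "0 \<le> empirical_density H G" "empirical_density H G \<le> 1"
    unfolding empirical_density_injective_homs[OF assms] by (auto simp: divide_le_eq_1)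
qed

lemma simple_graph_K2: "simple_graph K2" and verts_K2: "verts K2 = {1, 2}" and card_K2: "card (verts K2) = 2"
  by (auto simp: K2_def simple_graph_def)

lemma simple_graph_C4: "simple_graph C4" and card_C4: "card (verts C4) = 4"
  by (auto simp: C4_def simple_graph_def)

text \<open>
  Witnessed by the injection \<open>1 \<mapsto> u\<close>, \<open>2 \<mapsto> v\<close>: the homomorphisms from \<open>K2\<close> determine the edges.
\<close>

lemma edge_iff_hom_K2:
  assumes G: "G \<in> simple_graphs_on {1..n}" and uv: "u \<in> {1..n}" "v \<in> {1..n}" "u \<noteq> v"
  shows "\<exists>f\<in>injections (verts K2) {1..n}. f \<in> injective_homs K2 G \<longleftrightarrow> {u, v} \<in> edges G"
proof
  let ?f = "\<lambda>x\<in>{1, 2::nat}. if x = 1 then u else v"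
  have im: "?f ` {1, 2} = {u, v}" by auto
  show I: "?f \<in> injections (verts K2) {1..n}"
    using uv by (auto simp: injections_def verts_K2 inj_on_def)
  show "?f \<in> injective_homs K2 G \<longleftrightarrow> {u, v} \<in> edges G"
    using I im simple_graphs_on_D(2)[OF G] by (simp add: injective_homs_def K2_def)
qed

lemma empirical_density_edgeless:
  assumes H: "simple_graph H" "edges H \<noteq> {}" and n: "card (verts H) \<le> n" "2 \<le> n"
    and G: "G \<in> simple_graphs_on {1..n}" and K: "empirical_density K2 G = 0"
  shows "empirical_density H G = 0"
proof -
  have fin: "finite (injections (verts K2) {1..n})" by (simp add: finite_injections verts_K2)
  have "card (injections (verts K2) {1..n}) \<noteq> 0"
    using card_injections[of "verts K2" n] falling_factorial_pos[of "card (verts K2)" n] n(2)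
    by (auto simp: card_K2 verts_K2 numeral_2_eq_2)
  then have "card (injective_homs K2 G) = 0"
    using K empirical_density_injective_homs[OF simple_graph_K2 _ G] n(2) by (simp add: card_K2)
  then have none: "injective_homs K2 G = {}"
    using finite_subset[OF injective_homs_subset[OF G] fin] by simp
  have "edges G = {}"
  proof (rule ccontr)
    assume "edges G \<noteq> {}"
    then obtain e where e: "e \<in> edges G" by blast
    obtain u v where uv: "e = {u, v}" "(u, v) \<in> oriented_edges G"
      using edge_obtain_oriented[OF simple_graphs_on_D(1)[OF G] e] .
    then have "u \<in> {1..n}" "v \<in> {1..n}" "u \<noteq> v"
      using oriented_edges_subset[OF simple_graphs_on_D(1)[OF G]] simple_graphs_on_D(2)[OF G]
      by (auto simp: oriented_edges_def)
    then show False using edge_iff_hom_K2[OF G] none e uv(1) by blast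
  qed
  then have "injective_homs H G = {}" using H(2) by (auto simp: injective_homs_def)
  then show ?thesis using empirical_density_injective_homs[OF H(1) n(1) G] by simp
qed

lemma empirical_density_complete:
  assumes H: "simple_graph H" and n: "card (verts H) \<le> n" "2 \<le> n"
    and G: "G \<in> simple_graphs_on {1..n}" and K: "empirical_density K2 G = 1"
  shows "empirical_density H G = 1"
proof -
  have V: "finite (verts H)" using H by (simp add: simple_graph_def)
  have fin: "finite (injections (verts K2) {1..n})" by (simp add: finite_injections verts_K2)
  have "card (injective_homs K2 G) = card (injections (verts K2) {1..n})"
    using K empirical_density_injective_homs[OF simple_graph_K2 _ G] n(2)
    by (simp add: card_K2 divide_eq_1_iff)
  then have all: "injective_homs K2 G = injections (verts K2) {1..n}"
    using card_subset_eq[OF fin injective_homs_subset[OF G]] by simp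
  have complete: "{u, v} \<in> edges G" if "u \<in> {1..n}" "v \<in> {1..n}" "u \<noteq> v" for u v
    using edge_iff_hom_K2[OF G that] all by auto
  have "f ` e \<in> edges G" if f: "f \<in> injections (verts H) {1..n}" and e: "e \<in> edges H" for f e
  proof -
    obtain a b where ab: "e = {a, b}" "(a, b) \<in> oriented_edges H"
      using edge_obtain_oriented[OF H e] .
    then have "a \<in> verts H" "b \<in> verts H" "a \<noteq> b"
      using oriented_edges_subset[OF H] by (auto simp: oriented_edges_def)
    then have "f a \<in> {1..n}" "f b \<in> {1..n}" "f a \<noteq> f b"
      using f by (auto simp: injections_def dest: inj_onD)
    then show ?thesis using complete ab(1) by simp
  qed
  then have "injective_homs H G = injections (verts H) {1..n}"
    by (auto simp: injective_homs_def simple_graphs_on_D(2)[OF G])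
  moreover have "card (injections (verts H) {1..n}) \<noteq> 0"
    using card_injections[OF V n(1)] falling_factorial_pos[OF n(1)] by auto
  ultimately show ?thesis using empirical_density_injective_homs[OF H n(1) G] by simp
qed

section \<open>Consistency of the test\<close>

text \<open>
  By \<open>empirical_density_edgeless\<close> and \<open>empirical_density_complete\<close>, a positive gap forces the edge
  density into the open unit interval, where the denominator is positive and at most \<open>4 * sqrt 2\<close>.
  The exponent \<open>3 / 2\<close> is lowered to \<open>1\<close>, as \<open>n\<close> still diverges.
\<close>

lemma test_statistic_lower_bound:
  assumes n: "4 \<le> n" and G: "G \<in> simple_graphs_on {1..n}" and d: "d > 0"
    and gap: "d \<le> \<bar>empirical_density K2 G ^ 4 - empirical_density C4 G\<bar>"
  shows "real n * d / (4 * sqrt 2) \<le> \<bar>test_statistic n G\<bar>"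
proof -
  define p where "p = empirical_density K2 G"
  define c where "c = 4 * sqrt 2 * p ^ 3 * (1 - p)"
  have "0 \<le> p" "p \<le> 1"
    using empirical_density_bounds[OF simple_graph_K2 _ G] n by (simp_all add: p_def card_K2)
  moreover have "p \<noteq> 0"
    using empirical_density_edgeless[OF simple_graph_C4 _ _ _ G] gap d n
    by (auto simp: p_def card_C4 C4_def)
  moreover have "p \<noteq> 1"
    using empirical_density_complete[OF simple_graph_C4 _ _ G] gap d n by (auto simp: p_def card_C4)
  ultimately have p: "0 < p" "p < 1" by auto
  have "p ^ 3 * (1 - p) \<le> 1 * 1" using p by (intro mult_mono power_le_one) auto
  then have c: "0 < c" "c \<le> 4 * sqrt 2" using p by (simp_all add: c_def mult.assoc)
  have "real n = real n powr 1" using n by simp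
  also have "\<dots> \<le> real n powr (3 / 2)" using n by (intro powr_mono) auto
  finally have "real n * (d / (4 * sqrt 2))
      \<le> real n powr (3 / 2) * (\<bar>p ^ 4 - empirical_density C4 G\<bar> / c)"
    using gap d c by (intro mult_mono frac_le) (auto simp: p_def)
  also have "\<dots> = \<bar>test_statistic n G\<bar>"
    using c(1) by (simp add: test_statistic_def abs_mult flip: p_def c_def)
  finally show ?thesis by simp
qed

theorem proposition6p2:
  fixes \<alpha> :: real
    and W :: "real \<Rightarrow> real \<Rightarrow> real"
    and M :: "nat \<Rightarrow> 'a measure"
    and G :: "nat \<Rightarrow> 'a \<Rightarrow> graph"
  assumes "0 < \<alpha>" and "\<alpha> < 1"
    and "graphon W"
    and "\<bar>hom_density K2 W ^ 4 - hom_density C4 W\<bar> > 0"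
    and "\<And>n. n \<ge> 1 \<Longrightarrow> prob_space (M n)"
    and "\<And>n. n \<ge> 1 \<Longrightarrow> G n \<in> measurable (M n) (count_space (simple_graphs_on {1..n}))"
    and "\<And>n. n \<ge> 1 \<Longrightarrow>
           distr (M n) (count_space (simple_graphs_on {1..n})) (G n) = W_random_graph n W"
  shows "(\<lambda>n. measure (M n)
             {\<omega> \<in> space (M n).
                \<bar>test_statistic n (G n \<omega>)\<bar> > quantile std_normal_distribution (1 - \<alpha> / 2)})
           \<longlonglongrightarrow> 1"
proof -
  note W = \<open>graphon W\<close>
  define z where "z = quantile std_normal_distribution (1 - \<alpha> / 2)"
  define d where "d = \<bar>hom_density K2 W ^ 4 - hom_density C4 W\<bar>"
  have d: "d > 0" using assms(4) by (simp add: d_def)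
  \<comment> \<open>If both densities deviate by less than \<open>a\<close>, then \<open>p\<^sup>4 - q\<close> moves by at most \<open>4 a + a = d / 2\<close>,
    because the fourth power is 4-Lipschitz on the unit interval.\<close>
  define a where "a = d / 10"
  have a: "a > 0" using d by (simp add: a_def)
  define P where "P n = measure (M n) {\<omega> \<in> space (M n). \<bar>test_statistic n (G n \<omega>)\<bar> > z}" for n
  \<comment> \<open>\<open>16\<close> and \<open>256\<close> are the values of \<open>k\<^sup>2 2\<^sup>k\<close> for \<open>k = 2\<close> and \<open>k = 4\<close> vertices; there, \<open>n\<close> must
    be at least \<open>2 k\<close>, which is \<open>8\<close> for the 4-cycle.\<close>
  define C where "C = (16 + 256) / a\<^sup>2"
  have upper: "P n \<le> 1" if "1 \<le> n" for n
    using prob_space.prob_le_1[OF assms(5)[OF that]] by (simp add: P_def)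
  have lower: "1 - C / real n \<le> P n" if n: "8 \<le> n" and large: "z * (8 * sqrt 2) / d < real n" for n
  proof -
    interpret R: prob_space "W_random_graph n W" by (rule prob_space_W_random_graph[OF W])
    let ?S = "simple_graphs_on {1..n}"
    define dev where "dev H = {G \<in> ?S. a \<le> \<bar>empirical_density H G - hom_density H W\<bar>}" for H
    define R where "R = {G \<in> ?S. \<bar>test_statistic n G\<bar> > z}"
    have "P n = measure (distr (M n) (count_space ?S) (G n)) R"
    proof -
      have G: "G n \<in> measurable (M n) (count_space ?S)" using assms(6) n by simp
      have "G n -` R \<inter> space (M n) = {\<omega> \<in> space (M n). \<bar>test_statistic n (G n \<omega>)\<bar> > z}"
        using measurable_space[OF G] by (auto simp: R_def)
      then show ?thesis by (subst measure_distr[OF G]) (auto simp: P_def R_def)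
    qed
    then have PR: "P n = R.prob R" using assms(7) n by simp
    have "?S \<subseteq> R \<union> (dev K2 \<union> dev C4)"
    proof
      fix g assume g: "g \<in> ?S"
      show "g \<in> R \<union> (dev K2 \<union> dev C4)"
      proof (cases "g \<in> dev K2 \<union> dev C4")
        case False
        define p q where "p = empirical_density K2 g" and "q = empirical_density C4 g"
        have close: "\<bar>p - hom_density K2 W\<bar> < a" "\<bar>q - hom_density C4 W\<bar> < a"
          using False g by (auto simp: dev_def p_def q_def)
        have "\<bar>p ^ 4 - hom_density K2 W ^ 4\<bar> \<le> 4 * \<bar>p - hom_density K2 W\<bar>"
          using norm_power_diff[of p "hom_density K2 W" 4] hom_density_bounds[OF W simple_graph_K2]
            empirical_density_bounds[OF simple_graph_K2 _ g] n by (simp add: p_def card_K2)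
        moreover have "d \<le> \<bar>p ^ 4 - q\<bar> + \<bar>p ^ 4 - hom_density K2 W ^ 4\<bar> + \<bar>q - hom_density C4 W\<bar>"
          unfolding d_def by linarith
        ultimately have "d / 2 \<le> \<bar>p ^ 4 - q\<bar>" using close by (simp add: a_def)
        then have "real n * (d / 2) / (4 * sqrt 2) \<le> \<bar>test_statistic n g\<bar>"
          using test_statistic_lower_bound[OF _ g, of "d / 2"] n d by (simp add: p_def q_def)
        moreover have "z < real n * (d / 2) / (4 * sqrt 2)"
          using large d by (simp add: field_simps)
        ultimately show ?thesis using g by (simp add: R_def)
      qed simp
    qed
    then have "R.prob ?S \<le> R.prob (R \<union> (dev K2 \<union> dev C4))"
      by (intro R.finite_measure_mono) (auto simp: R_def dev_def)
    also have "\<dots> \<le> R.prob R + (R.prob (dev K2) + R.prob (dev C4))"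
    proof -
      have "R \<in> R.events" "dev K2 \<in> R.events" "dev C4 \<in> R.events"
        by (auto simp: R_def dev_def)
      then show ?thesis
        using measure_Un_le[of R "W_random_graph n W" "dev K2 \<union> dev C4"]
          measure_Un_le[of "dev K2" "W_random_graph n W" "dev C4"] sets.Un by fastforce
    qed
    also have "R.prob ?S = 1" using R.prob_space by simp
    finally have "1 \<le> P n + (R.prob (dev K2) + R.prob (dev C4))" by (simp add: PR)
    moreover have "R.prob (dev K2) \<le> 16 / real n / a\<^sup>2"
      using empirical_density_concentration[OF W simple_graph_K2 _ _ a, of n] n
      by (simp add: dev_def card_K2)
    moreover have "R.prob (dev C4) \<le> 256 / real n / a\<^sup>2"
      using empirical_density_concentration[OF W simple_graph_C4 _ _ a, of n] n
      by (simp add: dev_def card_C4)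
    moreover have "C / real n = 16 / real n / a\<^sup>2 + 256 / real n / a\<^sup>2"
      by (simp add: C_def add_divide_distrib)
    ultimately show ?thesis by linarith
  qed
  have "P \<longlonglongrightarrow> 1"
  proof (rule tendsto_sandwich)
    show "eventually (\<lambda>n. 1 - C / real n \<le> P n) sequentially"
      using eventually_ge_at_top[of 8] filterlim_real_sequentially[THEN filterlim_at_top_dense[THEN iffD1], rule_format, of "z * (8 * sqrt 2) / d"]
      by eventually_elim (rule lower)
    show "eventually (\<lambda>n. P n \<le> 1) sequentially"
      using eventually_ge_at_top[of 1] by eventually_elim (rule upper)
    have "(\<lambda>n. 1 - C / real n) \<longlonglongrightarrow> 1 - 0"
      by (intro tendsto_diff tendsto_const lim_const_over_n)
    then show "(\<lambda>n. 1 - C / real n) \<longlonglongrightarrow> 1" by simp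
  qed simp
  then show ?thesis unfolding P_def z_def .
qed

end
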